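(* Fix $0<\alpha<1$. Suppose that in Step 1 of the schema described in the context the confidence region $\mathcal{P}(\mathcal{S},\alpha,\epsilon)\equiv\mathcal{P}(\mathcal{S},\alpha)$ does not depend on $\epsilon$, and let $\{\mathcal{U}(\mathcal{S},\epsilon,\alpha):0<\epsilon<1\}$ be the resulting family of sets obtained from the schema. (a) With probability at least $1-\alpha$ with respect to the sampling, $\{\mathcal{U}(\mathcal{S},\epsilon,\alpha):0<\epsilon<1\}$ simultaneously implies a probabilistic guarantee for $\mathbb{P}^*$. (b) Let $f_1,\dots,f_m$ be functions with $f_j(\mathbf{u},\mathbf{x})$ concave in $\mathbf{u}$ for every $\mathbf{x}$, and let $0<\overline{\epsilon}<1$. With probability at least $1-\alpha$ with respect to the sampling, every $\mathbf{x}$ for which $$\exists\,\epsilon_1,\dots,\epsilon_m>0,\ \ \epsilon_1+\dots+\epsilon_m\le\overline{\epsilon}:\quad f_j(\mathbf{u},\mathbf{x})\le0\ \ \forall\mathbf{u}\in\mathcal{U}(\mathcal{S},\epsilon_j,\alpha),\ \ j=1,\dots,m,$$ satisfies $$\mathbb{P}^*\Big(\max_{j=1,\dots,m}f_j(\tilde{\mathbf{u}},\mathbf{x})\le0\Big)\ge1-\overline{\epsilon}.$$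
   Context: $\mathbb{P}^*$ is an unknown Borel probability measure on $\mathbb{R}^d$, $\tilde{\mathbf{u}}$ is a random vector, and $\mathcal{S}=\{\hat{\mathbf{u}}^1,\dots,\hat{\mathbf{u}}^N\}$ is drawn i.i.d. from $\mathbb{P}^*$; "probability with respect to the sampling" refers to the $N$-fold product measure $\mathbb{P}^*_{\mathcal{S}}$. For a probability measure $\mathbb{P}$, $\mathrm{VaR}_\epsilon^{\mathbb{P}}(\mathbf{v})=\inf\{t:\mathbb{P}(\tilde{\mathbf{u}}^T\mathbf{v}\le t)\ge 1-\epsilon\}$. The support function is $\delta^*(\mathbf{v}\mid\mathcal{U})=\sup_{\mathbf{u}\in\mathcal{U}}\mathbf{v}^T\mathbf{u}$. A function $g$ is positively homogeneous if $g(\lambda\mathbf{v})=\lambda g(\mathbf{v})$ for all $\lambda>0$. A set $\mathcal{U}$ implies a probabilistic guarantee for $\mathbb{P}^*$ at level $\epsilon$ if for every $\mathbf{x}^*\in\mathbb{R}^k$ and every real-valued $f(\mathbf{u},\mathbf{x})$ concave in $\mathbf{u}$ for all $\mathbf{x}$: if $f(\mathbf{u},\mathbf{x}^* )\le0$ for all $\mathbf{u}\in\mathcal{U}$, then $\mathbb{P}^*(f(\tilde{\mathbf{u}},\mathbf{x}^* )\le0)\ge1-\epsilon$. A family $\{\mathcal{U}(\epsilon):0<\epsilon<1\}$ simultaneously implies a probabilistic guarantee for $\mathbb{P}^*$ if, for all $0<\epsilon<1$, $\mathcal{U}(\epsilon)$ implies a probabilistic guarantee for $\mathbb{P}^*$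 at level $\epsilon$. Schema (for each $0<\epsilon<1$). Step 1: let $\mathcal{P}(\mathcal{S},\alpha,\epsilon)$ be the confidence region of a hypothesis test at level $\alpha$, i.e. a data-dependent set of probability measures such that $\mathbb{P}^*_{\mathcal{S}}(\mathbb{P}^*\in\mathcal{P}(\mathcal{S},\alpha,\epsilon))\ge1-\alpha$. Step 2: construct a (real-valued) convex, positively homogeneous in $\mathbf{v}$, function $g(\mathbf{v},\mathcal{S},\epsilon,\alpha)$ with $\sup_{\mathbb{P}\in\mathcal{P}(\mathcal{S},\alpha,\epsilon)}\mathrm{VaR}_\epsilon^{\mathbb{P}}(\mathbf{v})\le g(\mathbf{v},\mathcal{S},\epsilon,\alpha)$ for all $\mathbf{v}\in\mathbb{R}^d$. Step 3: let $\mathcal{U}(\mathcal{S},\epsilon,\alpha)$ be the closed convex set with $\delta^*(\mathbf{v}\mid\mathcal{U}(\mathcal{S},\epsilon,\alpha))=g(\mathbf{v},\mathcal{S},\epsilon,\alpha)$ for all $\mathbf{v}$. *)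

theory Defs
  imports "HOL-Probability.Probability"
begin

definition borel_prob :: "'a::topological_space measure \<Rightarrow> bool" where
  "borel_prob P \<longleftrightarrow> prob_space P \<and> sets P = sets borel"

text \<open>The joint law of an i.i.d. sample of size \<open>N\<close>. A sample is a function on the indices
  \<open>1, \<dots>, N\<close>, so its order and repetitions are kept.\<close>

definition sampling :: "nat \<Rightarrow> 'a measure \<Rightarrow> (nat \<Rightarrow> 'a) measure" where
  "sampling N P = PiM {1..N} (\<lambda>_. P)"

text \<open>The event \<open>E\<close> need not be measurable (it may involve uncountable intersections over
  functions, decisions or levels), so the statement that it has probability at least \<open>p\<close> is read
  as: it contains a measurable event of probability at least \<open>p\<close>.\<close>

definition with_prob_ge :: "'s measure \<Rightarrow> real \<Rightarrow> ('s \<Rightarrow> bool) \<Rightarrow> bool" where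
  "with_prob_ge M p E \<longleftrightarrow> (\<exists>A \<in> sets M. A \<subseteq> {s \<in> space M. E s} \<and> p \<le> measure M A)"

lemma with_prob_ge_measurable:
  assumes "prob_space M" and "{s \<in> space M. E s} \<in> sets M"
  shows "with_prob_ge M p E \<longleftrightarrow> p \<le> measure M {s \<in> space M. E s}"
proof -
  interpret prob_space M by fact
  show ?thesis
    unfolding with_prob_ge_def using assms(2) finite_measure_mono by (meson order.refl order_trans)
qed

text \<open>For \<open>0 < \<epsilon> < 1\<close> and a Borel probability measure \<open>P\<close> the set below is nonempty and bounded
  below, so the infimum over the reals is the intended one.\<close>

definition VaR :: "'a::euclidean_space measure \<Rightarrow> real \<Rightarrow> 'a \<Rightarrow> real" where
  "VaR P \<epsilon> v = Inf {t. 1 - \<epsilon> \<le> measure P {u. u \<bullet> v \<le> t}}"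

text \<open>Extended-real valued: \<open>-\<infinity>\<close> on the empty set, \<open>\<infinity>\<close> in unbounded directions.\<close>

definition support_fun :: "'a::euclidean_space set \<Rightarrow> 'a \<Rightarrow> ereal" where
  "support_fun U v = (SUP u\<in>U. ereal (v \<bullet> u))"

definition pos_homogeneous :: "('a::real_vector \<Rightarrow> real) \<Rightarrow> bool" where
  "pos_homogeneous g \<longleftrightarrow> (\<forall>c>0. \<forall>v. g (c *\<^sub>R v) = c * g v)"

text \<open>The first argument only carries the dimension \<open>k\<close> of the decision space. The event
  \<open>f u x \<le> 0\<close> is measurable because a concave function on the whole space is continuous.\<close>

definition implies_guarantee ::
  "'k::finite itself \<Rightarrow> (real^'d) measure \<Rightarrow> real \<Rightarrow> (real^'d) set \<Rightarrow> bool" where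
  "implies_guarantee (_ :: 'k itself) P \<epsilon> U \<longleftrightarrow>
     (\<forall>(x0 :: real^'k) (f :: real^'d \<Rightarrow> real^'k \<Rightarrow> real).
        (\<forall>x. concave_on UNIV (\<lambda>u. f u x)) \<longrightarrow> (\<forall>u\<in>U. f u x0 \<le> 0) \<longrightarrow>
        1 - \<epsilon> \<le> measure P {u. f u x0 \<le> 0})"

definition simultaneously_implies_guarantee ::
  "'k::finite itself \<Rightarrow> (real^'d) measure \<Rightarrow> (real \<Rightarrow> (real^'d) set) \<Rightarrow> bool" where
  "simultaneously_implies_guarantee K P U \<longleftrightarrow>
     (\<forall>\<epsilon>. 0 < \<epsilon> \<and> \<epsilon> < 1 \<longrightarrow> implies_guarantee K P \<epsilon> (U \<epsilon>))"

definition confidence_region ::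
  "nat \<Rightarrow> 'a::topological_space measure \<Rightarrow> real \<Rightarrow> ((nat \<Rightarrow> 'a) \<Rightarrow> 'a measure set) \<Rightarrow> bool" where
  "confidence_region N P \<alpha> R \<longleftrightarrow>
     (\<forall>s \<in> space (sampling N P). \<forall>Q \<in> R s. borel_prob Q) \<and>
     with_prob_ge (sampling N P) (1 - \<alpha>) (\<lambda>s. P \<in> R s)"

end

theory Submission
  imports Defs
begin

text \<open>The guarantee is deterministic once the true law \<open>Pstar\<close> lies in the confidence region. Then
  \<open>VaR Pstar \<epsilon> v\<close> is at most the support function of \<open>U \<epsilon>\<close> in every direction \<open>v\<close>. If a
  concave \<open>f\<close> is nonpositive on \<open>U \<epsilon>\<close>, the violation set \<open>f > 0\<close> is open, convex and disjoint
  from \<open>U \<epsilon>\<close>, so a hyperplane separates the two: with its normal \<open>v\<close>, the violation set lies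
  strictly beyond the support value of \<open>U \<epsilon>\<close> in direction \<open>v\<close>, hence strictly beyond the Value at
  Risk, where the law has mass at most \<open>\<epsilon>\<close>. This is lemma \<open>guarantee_of_VaR_le_support_fun\<close>.

  Since the region does not depend on \<open>\<epsilon>\<close>, the single event that it contains \<open>Pstar\<close>, of
  probability at least \<open>1 - \<alpha>\<close>, serves all levels at once; this is (a). On that same event the
  levels may be chosen after seeing the sample and the decision, and (b) follows from the union
  bound over the constraints.\<close>

lemma with_prob_ge_mono:
  assumes "with_prob_ge M p E" and "\<And>s. s \<in> space M \<Longrightarrow> E s \<Longrightarrow> E' s"
  shows "with_prob_ge M p E'"
proof -
  obtain A where "A \<in> sets M" "A \<subseteq> {s \<in> space M. E s}" "p \<le> measure M A"
    using assms(1) unfolding with_prob_ge_def by blast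
  then show ?thesis
    unfolding with_prob_ge_def using assms(2) by (intro bexI[of _ A]) auto
qed

lemma space_borel_prob: "borel_prob P \<Longrightarrow> space P = UNIV"
  unfolding borel_prob_def by (metis sets_eq_imp_space_eq space_borel)

lemma concave_on_UNIV_continuous:
  fixes h :: "'a::euclidean_space \<Rightarrow> real"
  assumes "concave_on UNIV h"
  shows "continuous_on UNIV h"
  using convex_on_continuous[of UNIV "\<lambda>u. - h u"] assms continuous_on_minus[of UNIV "\<lambda>u. - h u"]
  by (simp add: concave_on_def)

text \<open>The infimum defining the Value at Risk is attained: distribution functions are continuous
  from the right, and their limits at the two infinities make the set of admissible thresholds
  nonempty and bounded below.\<close>

lemma measure_le_VaR:
  fixes P :: "'a::euclidean_space measure"
  assumes P: "borel_prob P" and eps: "0 < \<epsilon>" "\<epsilon> < 1"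
  shows "1 - \<epsilon> \<le> measure P {u. u \<bullet> v \<le> VaR P \<epsilon> v}"
proof -
  interpret prob_space P using P by (simp add: borel_prob_def)
  have sets_P: "sets P = sets borel" using P by (simp add: borel_prob_def)
  define D where "D = distr P borel (\<lambda>u. u \<bullet> v)"
  have meas: "(\<lambda>u. u \<bullet> v) \<in> borel_measurable P"
    using sets_P by (simp add: measurable_cong_sets[OF sets_P refl])
  interpret D: real_distribution D
    unfolding D_def using meas by (rule real_distribution_distr)
  have cdf_D: "cdf D t = measure P {u. u \<bullet> v \<le> t}" for t
    unfolding cdf_def D_def using meas
    by (subst measure_distr) (auto simp: vimage_def space_borel_prob[OF P])
  let ?T = "{t. 1 - \<epsilon> \<le> cdf D t}"
  have VaR_eq: "VaR P \<epsilon> v = Inf ?T"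
    by (simp add: VaR_def cdf_D)
  have "eventually (\<lambda>t. 1 - \<epsilon> < cdf D t) at_top"
    by (rule order_tendstoD(1)[OF D.cdf_lim_at_top_prob]) (use eps in simp)
  then obtain t0 where t0: "1 - \<epsilon> < cdf D t0"
    by (meson eventually_at_top_linorder order_refl)
  then have nonempty: "?T \<noteq> {}" by (auto intro: less_imp_le)
  have "eventually (\<lambda>t. cdf D t < 1 - \<epsilon>) at_bot"
    by (rule order_tendstoD(2)[OF D.cdf_lim_at_bot]) (use eps in simp)
  then obtain b where b: "\<And>t. t \<le> b \<Longrightarrow> cdf D t < 1 - \<epsilon>"
    by (auto simp: eventually_at_bot_linorder)
  have bdd: "bdd_below ?T"
  proof (rule bdd_belowI)
    fix t assume "t \<in> ?T"
    then show "b \<le> t" using b[of t] by (cases "t \<le> b") auto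
  qed
  have above: "1 - \<epsilon> \<le> cdf D t" if "Inf ?T < t" for t
  proof -
    obtain t' where "t' \<in> ?T" "t' < t"
      using cInf_lessD[OF nonempty \<open>Inf ?T < t\<close>] by blast
    then show ?thesis using D.cdf_nondecreasing[of t' t] by simp
  qed
  have "(cdf D \<longlongrightarrow> cdf D (Inf ?T)) (at_right (Inf ?T))"
    using D.cdf_is_right_cont by (simp add: continuous_within)
  then have "1 - \<epsilon> \<le> cdf D (Inf ?T)"
    by (rule tendsto_lowerbound)
      (auto simp: eventually_at_right_less intro: eventually_mono[OF eventually_at_right_less above])
  then show ?thesis by (simp add: VaR_eq cdf_D)
qed

text \<open>Concavity is used twice: it makes the violation set \<open>h > 0\<close> convex, so that it can be
  separated from \<open>U\<close>, and open, so that it lies strictly beyond the separating hyperplane. The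
  strictness matters, because the hyperplane itself may carry mass.\<close>

lemma guarantee_of_VaR_le_support_fun:
  fixes P :: "'a::euclidean_space measure" and h :: "'a \<Rightarrow> real"
  assumes P: "borel_prob P" and eps: "0 < \<epsilon>" "\<epsilon> < 1"
    and U: "convex U"
    and le: "\<And>v. ereal (VaR P \<epsilon> v) \<le> support_fun U v"
    and h: "concave_on UNIV h" and neg: "\<And>u. u \<in> U \<Longrightarrow> h u \<le> 0"
  shows "1 - \<epsilon> \<le> measure P {u. h u \<le> 0}"
proof -
  interpret prob_space P using P by (simp add: borel_prob_def)
  have sets_P: "sets P = sets borel" using P by (simp add: borel_prob_def)
  have cont: "continuous_on UNIV h" using h by (rule concave_on_UNIV_continuous)
  have safe_set: "{u. h u \<le> 0} \<in> sets P"
    unfolding sets_P by (intro borel_closed closed_Collect_le cont continuous_on_const)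
  let ?C = "{u. 0 < h u}"
  show ?thesis
  proof (cases "?C = {}")
    case True
    then have "{u. h u \<le> 0} = space P"
      by (auto simp: space_borel_prob[OF P] not_less)
    then show ?thesis using eps prob_space by simp
  next
    case False
    have "open ?C" by (intro open_Collect_less cont continuous_on_const)
    have "convex ?C"
    proof -
      have "0 < h ((1 - t) *\<^sub>R x + t *\<^sub>R y)"
        if "0 < h x" "0 < h y" "0 \<le> t" "t \<le> 1" for x y t
      proof -
        have "0 < (1 - t) * h x + t * h y"
          using that by (cases "t = 0") (auto intro!: add_nonneg_pos)
        also have "\<dots> \<le> h ((1 - t) *\<^sub>R x + t *\<^sub>R y)"
          using concave_onD[OF h \<open>0 \<le> t\<close> \<open>t \<le> 1\<close>] by simp
        finally show ?thesis .
      qed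
      then show ?thesis by (auto simp: convex_alt)
    qed
    \<comment> \<open>The support function of the empty set is \<open>-\<infinity>\<close>, below every Value at Risk.\<close>
    have "U \<noteq> {}" using le[of 0] by (auto simp: support_fun_def bot_ereal_def)
    have "U \<inter> ?C = {}" using neg by (auto simp: not_less[symmetric])
    then obtain a b where a: "a \<noteq> 0" and aU: "\<And>u. u \<in> U \<Longrightarrow> a \<bullet> u \<le> b"
      and aC: "\<And>u. u \<in> ?C \<Longrightarrow> b \<le> a \<bullet> u"
      using separating_hyperplane_sets[OF U \<open>convex ?C\<close> \<open>U \<noteq> {}\<close> False] by blast
    have "?C \<subseteq> interior {u. b \<le> a \<bullet> u}"
      using \<open>open ?C\<close> aC by (intro interior_maximal) auto
    then have strict: "?C \<subseteq> {u. b < a \<bullet> u}"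
      using interior_halfspace_ge[OF a, of b] by simp
    have "support_fun U a \<le> ereal b"
      unfolding support_fun_def by (intro SUP_least) (simp add: aU)
    with le[of a] have "VaR P \<epsilon> a \<le> b"
      by (metis order_trans ereal_less_eq(3))
    with strict have "{u. u \<bullet> a \<le> VaR P \<epsilon> a} \<subseteq> {u. h u \<le> 0}"
      by (auto simp: inner_commute subset_iff simp flip: not_less)
    then have "measure P {u. u \<bullet> a \<le> VaR P \<epsilon> a} \<le> measure P {u. h u \<le> 0}"
      using safe_set by (rule finite_measure_mono)
    with measure_le_VaR[OF P eps, of a] show ?thesis by linarith
  qed
qed

lemma (in prob_space) prob_INT_ge_one_minus_sum:
  assumes "finite J" and meas: "\<And>j. j \<in> J \<Longrightarrow> A j \<in> events"
    and ge: "\<And>j. j \<in> J \<Longrightarrow> 1 - e j \<le> prob (A j)"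
  shows "1 - (\<Sum>j\<in>J. e j) \<le> prob {u \<in> space M. \<forall>j\<in>J. u \<in> A j}"
proof -
  let ?B = "\<Union>j\<in>J. space M - A j"
  have B: "?B \<in> events"
    using assms(1) meas by (intro sets.finite_UN sets.compl_sets)
  have "prob ?B \<le> (\<Sum>j\<in>J. prob (space M - A j))"
    using assms(1) meas by (intro finite_measure_subadditive_finite) auto
  also have "\<dots> \<le> (\<Sum>j\<in>J. e j)"
    by (intro sum_mono) (use ge meas in \<open>force simp: prob_compl\<close>)
  finally have "1 - (\<Sum>j\<in>J. e j) \<le> prob (space M - ?B)"
    using prob_compl[OF B] by simp
  moreover have "space M - ?B = {u \<in> space M. \<forall>j\<in>J. u \<in> A j}" by auto
  ultimately show ?thesis by simp
qed

text \<open>The \<open>e j\<close> are positive and their sum is below \<open>1\<close>, so each of them is a level covered by the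
  simultaneous guarantee, and the union bound adds up their violation probabilities.\<close>

lemma joint_guarantee_of_simultaneous:
  fixes f :: "'i \<Rightarrow> real^'d \<Rightarrow> real^'k \<Rightarrow> real"
  assumes P: "borel_prob P"
    and sim: "simultaneously_implies_guarantee TYPE('k::finite) P U"
    and J: "finite J" "J \<noteq> {}"
    and concave: "\<And>j x. j \<in> J \<Longrightarrow> concave_on UNIV (\<lambda>u. f j u x)"
    and pos: "\<And>j. j \<in> J \<Longrightarrow> 0 < e j" and sum: "(\<Sum>j\<in>J. e j) \<le> \<epsilon>" and "\<epsilon> < 1"
    and safe: "\<And>j u. j \<in> J \<Longrightarrow> u \<in> U (e j) \<Longrightarrow> f j u x \<le> 0"
  shows "1 - \<epsilon> \<le> measure P {u. (MAX j\<in>J. f j u x) \<le> 0}"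
proof -
  interpret prob_space P using P by (simp add: borel_prob_def)
  have sets_P: "sets P = sets borel" using P by (simp add: borel_prob_def)
  have single: "1 - e j \<le> prob {u. f j u x \<le> 0}" if j: "j \<in> J" for j
  proof -
    have "e j \<le> (\<Sum>j\<in>J. e j)"
      using J pos j by (intro member_le_sum) (auto intro: less_imp_le)
    then have "e j < 1" using sum \<open>\<epsilon> < 1\<close> by linarith
    with sim pos[OF j] have "implies_guarantee TYPE('k) P (e j) (U (e j))"
      by (simp add: simultaneously_implies_guarantee_def)
    then show ?thesis
      unfolding implies_guarantee_def using concave[OF j] safe[OF j] by blast
  qed
  have events: "{u. f j u x \<le> 0} \<in> events" if j: "j \<in> J" for j
  proof -
    have "continuous_on UNIV (\<lambda>u. f j u x)"
      using concave[OF j] by (rule concave_on_UNIV_continuous)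
    then show ?thesis
      unfolding sets_P by (intro borel_closed closed_Collect_le continuous_on_const)
  qed
  have "1 - \<epsilon> \<le> 1 - (\<Sum>j\<in>J. e j)" using sum by simp
  also have "\<dots> \<le> prob {u \<in> space P. \<forall>j\<in>J. u \<in> {u. f j u x \<le> 0}}"
    by (rule prob_INT_ge_one_minus_sum[OF J(1) events single])
  also have "{u \<in> space P. \<forall>j\<in>J. u \<in> {u. f j u x \<le> 0}} = {u. (MAX j\<in>J. f j u x) \<le> 0}"
    using J by (auto simp: space_borel_prob[OF P])
  finally show ?thesis .
qed

theorem theorem3:
  fixes Pstar :: "(real^'d) measure"
    and N :: nat
    and \<alpha> :: real
    and R :: "(nat \<Rightarrow> real^'d) \<Rightarrow> real \<Rightarrow> real \<Rightarrow> (real^'d) measure set"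
    and g :: "real^'d \<Rightarrow> (nat \<Rightarrow> real^'d) \<Rightarrow> real \<Rightarrow> real \<Rightarrow> real"
    and U :: "(nat \<Rightarrow> real^'d) \<Rightarrow> real \<Rightarrow> real \<Rightarrow> (real^'d) set"
  assumes Pstar: "borel_prob Pstar"
    and alpha: "0 < \<alpha>" "\<alpha> < 1"
    and region: "\<And>\<epsilon>. 0 < \<epsilon> \<Longrightarrow> \<epsilon> < 1 \<Longrightarrow> confidence_region N Pstar \<alpha> (\<lambda>s. R s \<alpha> \<epsilon>)"
    and region_indep: "\<And>s \<epsilon> \<epsilon>'. s \<in> space (sampling N Pstar) \<Longrightarrow> 0 < \<epsilon> \<Longrightarrow> \<epsilon> < 1 \<Longrightarrow>
           0 < \<epsilon>' \<Longrightarrow> \<epsilon>' < 1 \<Longrightarrow> R s \<alpha> \<epsilon> = R s \<alpha> \<epsilon>'"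
    and g_convex: "\<And>s \<epsilon>. s \<in> space (sampling N Pstar) \<Longrightarrow> 0 < \<epsilon> \<Longrightarrow> \<epsilon> < 1 \<Longrightarrow>
           convex_on UNIV (\<lambda>v. g v s \<epsilon> \<alpha>)"
    and g_homogeneous: "\<And>s \<epsilon>. s \<in> space (sampling N Pstar) \<Longrightarrow> 0 < \<epsilon> \<Longrightarrow> \<epsilon> < 1 \<Longrightarrow>
           pos_homogeneous (\<lambda>v. g v s \<epsilon> \<alpha>)"
    and g_bound: "\<And>s \<epsilon> v. s \<in> space (sampling N Pstar) \<Longrightarrow> 0 < \<epsilon> \<Longrightarrow> \<epsilon> < 1 \<Longrightarrow>
           (SUP Q\<in>R s \<alpha> \<epsilon>. ereal (VaR Q \<epsilon> v)) \<le> ereal (g v s \<epsilon> \<alpha>)"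
    and U_closed: "\<And>s \<epsilon>. s \<in> space (sampling N Pstar) \<Longrightarrow> 0 < \<epsilon> \<Longrightarrow> \<epsilon> < 1 \<Longrightarrow> closed (U s \<epsilon> \<alpha>)"
    and U_convex: "\<And>s \<epsilon>. s \<in> space (sampling N Pstar) \<Longrightarrow> 0 < \<epsilon> \<Longrightarrow> \<epsilon> < 1 \<Longrightarrow> convex (U s \<epsilon> \<alpha>)"
    and U_support: "\<And>s \<epsilon> v. s \<in> space (sampling N Pstar) \<Longrightarrow> 0 < \<epsilon> \<Longrightarrow> \<epsilon> < 1 \<Longrightarrow>
           support_fun (U s \<epsilon> \<alpha>) v = ereal (g v s \<epsilon> \<alpha>)"
  shows "with_prob_ge (sampling N Pstar) (1 - \<alpha>)
           (\<lambda>s. simultaneously_implies_guarantee TYPE('k::finite) Pstar (\<lambda>\<epsilon>. U s \<epsilon> \<alpha>))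
       \<and> (\<forall>(m::nat) (f :: nat \<Rightarrow> real^'d \<Rightarrow> real^'k \<Rightarrow> real) (\<epsilon>bar::real).
            1 \<le> m \<longrightarrow> (\<forall>j\<in>{1..m}. \<forall>x. concave_on UNIV (\<lambda>u. f j u x)) \<longrightarrow>
            0 < \<epsilon>bar \<longrightarrow> \<epsilon>bar < 1 \<longrightarrow>
            with_prob_ge (sampling N Pstar) (1 - \<alpha>)
              (\<lambda>s. \<forall>x :: real^'k.
                 (\<exists>e :: nat \<Rightarrow> real. (\<forall>j\<in>{1..m}. 0 < e j) \<and> (\<Sum>j=1..m. e j) \<le> \<epsilon>bar \<and>
                    (\<forall>j\<in>{1..m}. \<forall>u\<in>U s (e j) \<alpha>. f j u x \<le> 0)) \<longrightarrow>
                 1 - \<epsilon>bar \<le> measure Pstar {u. (MAX j\<in>{1..m}. f j u x) \<le> 0}))"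
proof -
  let ?M = "sampling N Pstar"
  let ?sim = "\<lambda>s. simultaneously_implies_guarantee TYPE('k) Pstar (\<lambda>\<epsilon>. U s \<epsilon> \<alpha>)"
  \<comment> \<open>The region is the same at all levels; the one at level \<open>1/2\<close> represents it.\<close>
  have covered: "with_prob_ge ?M (1 - \<alpha>) (\<lambda>s. Pstar \<in> R s \<alpha> (1/2))"
    using region[of "1/2"] by (simp add: confidence_region_def)
  have sim: "?sim s" if s: "s \<in> space ?M" and mem: "Pstar \<in> R s \<alpha> (1/2)" for s
    unfolding simultaneously_implies_guarantee_def implies_guarantee_def
  proof (intro allI impI)
    fix \<epsilon> :: real and x0 :: "real^'k" and f :: "real^'d \<Rightarrow> real^'k \<Rightarrow> real"
    assume "0 < \<epsilon> \<and> \<epsilon> < 1"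
      and f: "\<forall>x. concave_on UNIV (\<lambda>u. f u x)" "\<forall>u\<in>U s \<epsilon> \<alpha>. f u x0 \<le> 0"
    then have eps: "0 < \<epsilon>" "\<epsilon> < 1" by auto
    have "R s \<alpha> \<epsilon> = R s \<alpha> (1/2)" using eps by (intro region_indep[OF s]) auto
    then have mem_eps: "Pstar \<in> R s \<alpha> \<epsilon>" using mem by simp
    have "ereal (VaR Pstar \<epsilon> v) \<le> support_fun (U s \<epsilon> \<alpha>) v" for v
      unfolding U_support[OF s eps]
      using SUP_upper[OF mem_eps] g_bound[OF s eps] by (rule order_trans)
    then show "1 - \<epsilon> \<le> measure Pstar {u. f u x0 \<le> 0}"
      using f by (intro guarantee_of_VaR_le_support_fun[OF Pstar eps U_convex[OF s eps]]) auto
  qed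
  have simultaneous: "with_prob_ge ?M (1 - \<alpha>) ?sim"
    using covered sim by (rule with_prob_ge_mono)
  show ?thesis
  proof (intro conjI allI impI)
    show "with_prob_ge ?M (1 - \<alpha>) ?sim" by (rule simultaneous)
  next
    fix m :: nat and f :: "nat \<Rightarrow> real^'d \<Rightarrow> real^'k \<Rightarrow> real" and \<epsilon>bar :: real
    assume m: "1 \<le> m" and f: "\<forall>j\<in>{1..m}. \<forall>x. concave_on UNIV (\<lambda>u. f j u x)"
      and "\<epsilon>bar < 1"
    show "with_prob_ge ?M (1 - \<alpha>)
            (\<lambda>s. \<forall>x :: real^'k.
               (\<exists>e :: nat \<Rightarrow> real. (\<forall>j\<in>{1..m}. 0 < e j) \<and> (\<Sum>j=1..m. e j) \<le> \<epsilon>bar \<and>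
                  (\<forall>j\<in>{1..m}. \<forall>u\<in>U s (e j) \<alpha>. f j u x \<le> 0)) \<longrightarrow>
               1 - \<epsilon>bar \<le> measure Pstar {u. (MAX j\<in>{1..m}. f j u x) \<le> 0})"
    proof (rule with_prob_ge_mono[OF simultaneous], intro allI impI, elim exE conjE)
      fix s x and e :: "nat \<Rightarrow> real"
      assume "?sim s" "\<forall>j\<in>{1..m}. 0 < e j" "(\<Sum>j=1..m. e j) \<le> \<epsilon>bar"
        "\<forall>j\<in>{1..m}. \<forall>u\<in>U s (e j) \<alpha>. f j u x \<le> 0"
      then show "1 - \<epsilon>bar \<le> measure Pstar {u. (MAX j\<in>{1..m}. f j u x) \<le> 0}"
        using m f \<open>\<epsilon>bar < 1\<close>
        by (intro joint_guarantee_of_simultaneous[OF Pstar, where e = e]) auto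
    qed
  qed
qed

end
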